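(* The complement graph $\overline{K(n,k)}$ of the Kneser graph $K(n,k)$ is semi-transitive if and only if $n\leq 2k$.
   Context: For any two integers $k\geq 1$ and $n\geq k$, the Kneser graph $K(n,k)$ is the simple undirected graph whose vertices correspond to the $k$-element subsets of $[n]=\{1,2,\ldots,n\}$, where two distinct vertices are adjacent if and only if the two corresponding subsets are disjoint. Its complement $\overline{K(n,k)}$ has the same vertices, with two distinct vertices adjacent if and only if they are not adjacent in $K(n,k)$, that is, if and only if the corresponding subsets intersect. An orientation of a simple undirected graph (a choice of exactly one direction for each edge) is semi-transitive if it is acyclic (has no directed cycles) and, for any directed path $v_0\rightarrow v_1\rightarrow\cdots\rightarrow v_m$, either there is no edge between $v_0$ and $v_m$, or $v_i\rightarrow v_j$ is an edge for all $0\leq i<j\leq m$. An undirected graph is semi-transitive if it admits a semi-transitive orientation.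
   Formalization: The case k = 1 with n ≥ 3 is excluded: there K(n,1) is complete, so its complement has no edges and is semi-transitive although n > 2k; the equivalence is proved for all other k ≥ 1, n ≥ k. *)

theory Defs
  imports Main
begin

text \<open>A graph is a pair of a vertex set and a set of edges; an edge is a two-element vertex set.\<close>

type_synonym 'a ugraph = "'a set \<times> 'a set set"

abbreviation verts :: "'a ugraph \<Rightarrow> 'a set" where "verts G \<equiv> fst G"
abbreviation edges :: "'a ugraph \<Rightarrow> 'a set set" where "edges G \<equiv> snd G"

definition simple_graph :: "'a ugraph \<Rightarrow> bool" where
  "simple_graph G \<longleftrightarrow> (\<forall>e\<in>edges G. e \<subseteq> verts G \<and> card e = 2)"

definition complement_graph :: "'a ugraph \<Rightarrow> 'a ugraph" where
  "complement_graph G =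
     (verts G, {{u, v} |u v. u \<in> verts G \<and> v \<in> verts G \<and> u \<noteq> v \<and> {u, v} \<notin> edges G})"

definition kneser_verts :: "nat \<Rightarrow> nat \<Rightarrow> nat set set" where
  "kneser_verts n k = {A. A \<subseteq> {1..n} \<and> card A = k}"

definition kneser_graph :: "nat \<Rightarrow> nat \<Rightarrow> nat set ugraph" where
  "kneser_graph n k =
     (kneser_verts n k,
      {{A, B} |A B. A \<in> kneser_verts n k \<and> B \<in> kneser_verts n k \<and> A \<noteq> B \<and> A \<inter> B = {}})"

definition orientation :: "'a ugraph \<Rightarrow> ('a \<times> 'a) set \<Rightarrow> bool" where
  "orientation G D \<longleftrightarrow>
     (\<forall>u v. (u, v) \<in> D \<longrightarrow> {u, v} \<in> edges G) \<and>
     (\<forall>u v. {u, v} \<in> edges G \<longrightarrow> ((u, v) \<in> D \<longleftrightarrow> (v, u) \<notin> D))"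

text \<open>The vertices of a directed path need not be required to be distinct below: this is
  automatic when the relation is acyclic.\<close>

definition semi_transitive_orientation :: "'a ugraph \<Rightarrow> ('a \<times> 'a) set \<Rightarrow> bool" where
  "semi_transitive_orientation G D \<longleftrightarrow>
     orientation G D \<and> acyclic D \<and>
     (\<forall>(m::nat) v. (\<forall>i<m. (v i, v (Suc i)) \<in> D) \<longrightarrow>
        {v 0, v m} \<notin> edges G \<or> (\<forall>i j. i < j \<and> j \<le> m \<longrightarrow> (v i, v j) \<in> D))"

definition semi_transitive :: "'a ugraph \<Rightarrow> bool" where
  "semi_transitive G \<longleftrightarrow> (\<exists>D. semi_transitive_orientation G D)"

lemma simple_graph_kneser: "simple_graph (kneser_graph n k)"
  by (auto simp: simple_graph_def kneser_graph_def card_2_iff)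

lemma simple_graph_complement: "simple_graph (complement_graph G)"
  by (auto simp: simple_graph_def complement_graph_def card_2_iff)

lemma complement_kneser_edge_iff:
  assumes "A \<in> kneser_verts n k" "B \<in> kneser_verts n k" "A \<noteq> B"
  shows "{A, B} \<in> edges (complement_graph (kneser_graph n k)) \<longleftrightarrow> A \<inter> B \<noteq> {}"
  using assms by (auto simp: complement_graph_def kneser_graph_def doubleton_eq_iff)

text \<open>For \<open>k = 1\<close> the complement is edgeless, hence semi-transitive for every \<open>n\<close>; so the
  bound \<open>n \<le> 2 * k\<close> does not characterize semi-transitivity when \<open>k = 1\<close> and \<open>n \<ge> 3\<close>.\<close>

lemma semi_transitive_complement_kneser_1: "semi_transitive (complement_graph (kneser_graph n 1))"
proof -
  have "\<not> (A \<in> kneser_verts n 1 \<and> B \<in> kneser_verts n 1 \<and> A \<noteq> B \<and> {A, B} \<notin> edges (kneser_graph n 1))"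
    for A B
  proof
    assume "A \<in> kneser_verts n 1 \<and> B \<in> kneser_verts n 1 \<and> A \<noteq> B \<and> {A, B} \<notin> edges (kneser_graph n 1)"
    then have A: "A \<in> kneser_verts n 1" and B: "B \<in> kneser_verts n 1" and ne: "A \<noteq> B"
      and nE: "{A, B} \<notin> edges (kneser_graph n 1)"
      by simp_all
    obtain x where x: "A = {x}"
      using A unfolding kneser_verts_def by (blast elim: card_1_singletonE)
    obtain y where y: "B = {y}"
      using B unfolding kneser_verts_def by (blast elim: card_1_singletonE)
    have "A \<inter> B = {}"
      using ne unfolding x y by simp
    then have "{A, B} \<in> edges (kneser_graph n 1)"
      unfolding kneser_graph_def snd_conv using A B ne by blast
    with nE show False ..
  qed
  then have "edges (complement_graph (kneser_graph n 1)) = {}"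
    unfolding complement_graph_def kneser_graph_def fst_conv snd_conv by simp
  then have "semi_transitive_orientation (complement_graph (kneser_graph n 1)) {}"
    by (simp add: semi_transitive_orientation_def orientation_def acyclic_def)
  then show ?thesis
    unfolding semi_transitive_def by blast
qed

end

theory Submission
  imports Defs
begin

text \<open>
  The vertices of the complement of the Kneser graph are adjacent iff they are distinct
  intersecting \<open>k\<close>-sets.

  If \<open>n \<le> 2 * k\<close>, two \<open>k\<close>-sets can only be disjoint by being complementary in \<open>{1..n}\<close>. So the
  graph is complete multipartite, with parts of size at most two: \<open>A\<close> lies in the part
  \<open>{A, {1..n} - A}\<close>. Numbering the parts and directing every edge towards the larger number
  gives a transitive orientation, and transitive orientations are semi-transitive
  (\<open>complete_multipartite_semi_transitive\<close>, \<open>transitive_imp_semi_transitive_orientation\<close>).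

  Conversely, in a semi-transitive graph the neighbourhood of every vertex admits a transitive
  orientation (\<open>neighbourhood_transitive_orientation\<close>). If \<open>n \<ge> 2 * k + 1\<close> and \<open>k \<ge> 2\<close>, there
  are disjoint nonempty sets \<open>U\<close>, \<open>V\<close> of size \<open>k - 1\<close> and three further points \<open>a, b, c\<close>. The
  sets \<open>U \<union> {a}\<close>, \<open>U \<union> {b}\<close>, \<open>U \<union> {c}\<close> form a triangle, and each of them has a private
  neighbour, \<open>V \<union> {a}\<close>, \<open>V \<union> {b}\<close>, \<open>V \<union> {c}\<close> respectively, that is not adjacent to the other
  two. No graph containing this pattern is transitively orientable
  (\<open>no_transitive_orientation_triangle_private\<close>). As all six sets meet any \<open>k\<close>-set that
  intersects both \<open>U\<close> and \<open>V\<close>, the pattern lies in the neighbourhood of a vertex.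
\<close>

lemma orientation_not_refl: "orientation G D \<Longrightarrow> (x, x) \<notin> D"
  unfolding orientation_def by blast

lemma transitive_imp_semi_transitive_orientation:
  assumes "orientation G D" and "trans D"
  shows "semi_transitive_orientation G D"
proof -
  have "acyclic D"
    using assms(2) orientation_not_refl[OF assms(1)] by (simp add: acyclic_def trancl_id)
  moreover have "(v i, v j) \<in> D"
    if path: "\<forall>i<m. (v i, v (Suc i)) \<in> D" and "i < j" "j \<le> m" for m :: nat and v i j
    using \<open>i < j\<close> \<open>j \<le> m\<close>
  proof (induction j)
    case 0
    then show ?case by simp
  next
    case (Suc j)
    have step: "(v j, v (Suc j)) \<in> D"
      using path Suc.prems by simp
    show ?case
    proof (cases "i = j")
      case True
      then show ?thesis using step by simp
    next
      case False
      then have "(v i, v j) \<in> D" using Suc by simp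
      then show ?thesis using step \<open>trans D\<close> by (blast dest: transD)
    qed
  qed
  ultimately show ?thesis
    using assms(1) unfolding semi_transitive_orientation_def by blast
qed

text \<open>
  The hypothesis says that the colour classes of \<open>c\<close> are the parts of a complete multipartite
  graph. Any linear order on the finitely many colours gives a transitive orientation.
\<close>

lemma complete_multipartite_semi_transitive:
  assumes fin: "finite (verts G)"
    and sub: "\<And>x y. {x, y} \<in> edges G \<Longrightarrow> x \<in> verts G \<and> y \<in> verts G"
    and col: "\<And>x y. x \<in> verts G \<Longrightarrow> y \<in> verts G \<Longrightarrow> {x, y} \<in> edges G \<longleftrightarrow> c x \<noteq> c y"
  shows "semi_transitive G"
proof -
  obtain f :: "_ \<Rightarrow> nat" where f: "inj_on f (c ` verts G)"
    using finite_imp_inj_to_nat_seg[OF finite_imageI[OF fin, of c]] by blast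
  have number: "{x, y} \<in> edges G \<longleftrightarrow> f (c x) \<noteq> f (c y)"
    if "x \<in> verts G" "y \<in> verts G" for x y
    using col[OF that] that f by (metis imageI inj_on_contraD)
  define D where "D = {(x, y). x \<in> verts G \<and> y \<in> verts G \<and> f (c x) < f (c y)}"
  have "orientation G D"
    unfolding orientation_def
  proof (intro conjI allI impI)
    show "{x, y} \<in> edges G" if "(x, y) \<in> D" for x y
      using that number[of x y] unfolding D_def by simp
    show "(x, y) \<in> D \<longleftrightarrow> (y, x) \<notin> D" if "{x, y} \<in> edges G" for x y
      using that sub[OF that] number[of x y] unfolding D_def by auto
  qed
  moreover have "trans D"
    unfolding D_def trans_def by auto
  ultimately show ?thesis
    unfolding semi_transitive_def using transitive_imp_semi_transitive_orientation by blast
qed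

lemma semi_transitive_orientation_shortcut3:
  assumes D: "semi_transitive_orientation G D"
    and path: "(p, q) \<in> D" "(q, r) \<in> D" "(r, s) \<in> D" and edge: "{p, s} \<in> edges G"
  shows "(p, r) \<in> D" and "(q, s) \<in> D"
proof -
  define v where "v = (\<lambda>i::nat. if i = 0 then p else if i = 1 then q else if i = 2 then r else s)"
  have "\<forall>i<3. (v i, v (Suc i)) \<in> D"
    using path by (auto simp: v_def less_Suc_eq numeral_3_eq_3)
  moreover have "{v 0, v 3} \<in> edges G"
    using edge by (simp add: v_def)
  ultimately have short: "\<And>i j. i < j \<and> j \<le> 3 \<Longrightarrow> (v i, v j) \<in> D"
    using D unfolding semi_transitive_orientation_def by blast
  show "(p, r) \<in> D" using short[of 0 2] by (simp add: v_def)
  show "(q, s) \<in> D" using short[of 1 3] by (simp add: v_def)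
qed

text \<open>
  Split the neighbours of \<open>w\<close> into in-neighbours and out-neighbours. By acyclicity all edges
  between the two kinds go from in to out. Reversing exactly these edges makes the orientation
  of the neighbourhood transitive: each instance of transitivity comes from a shortcut of a
  directed path with three edges through \<open>w\<close> whose ends are adjacent.
\<close>

lemma neighbourhood_transitive_orientation:
  assumes "semi_transitive G"
  obtains T where
    "orientation ({x. {w, x} \<in> edges G}, {e \<in> edges G. e \<subseteq> {x. {w, x} \<in> edges G}}) T"
    "trans T"
proof -
  obtain D where D: "semi_transitive_orientation G D"
    using assms unfolding semi_transitive_def by blast
  then have ori: "orientation G D" and acy: "acyclic D"
    unfolding semi_transitive_orientation_def by blast+
  have D_edge: "{x, y} \<in> edges G" "{y, x} \<in> edges G" if "(x, y) \<in> D" for x y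
    using ori that unfolding orientation_def by (auto simp: insert_commute)
  have D_iff: "(x, y) \<in> D \<longleftrightarrow> (y, x) \<notin> D" if "{x, y} \<in> edges G" for x y
    using ori that unfolding orientation_def by blast
  define I where "I = {x. (x, w) \<in> D}"
  define O' where "O' = {x. (w, x) \<in> D}"
  have nbh: "{w, x} \<in> edges G \<longleftrightarrow> x \<in> I \<union> O'" for x
    unfolding I_def O'_def using D_edge D_iff by blast
  have disj: "x \<notin> O'" if "x \<in> I" for x
    using that D_edge D_iff unfolding I_def O'_def by blast
  have no_OI: "(x, y) \<notin> D" if "x \<in> O'" "y \<in> I" for x y
  proof
    assume "(x, y) \<in> D"
    then have "(w, w) \<in> D\<^sup>+"
      using that unfolding I_def O'_def by (blast intro: trancl.intros)
    then show False using acy unfolding acyclic_def by blast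
  qed
  define T where "T = {(x, y). (x \<in> I \<and> y \<in> I \<and> (x, y) \<in> D) \<or> (x \<in> O' \<and> y \<in> O' \<and> (x, y) \<in> D)
    \<or> (x \<in> O' \<and> y \<in> I \<and> (y, x) \<in> D)}"
  have "orientation ({x. {w, x} \<in> edges G}, {e \<in> edges G. e \<subseteq> {x. {w, x} \<in> edges G}}) T"
    unfolding orientation_def
  proof (intro conjI allI impI)
    fix x y
    assume "(x, y) \<in> T"
    then show "{x, y} \<in> edges ({x. {w, x} \<in> edges G}, {e \<in> edges G. e \<subseteq> {x. {w, x} \<in> edges G}})"
      unfolding T_def using D_edge by (auto simp: nbh)
  next
    fix x y
    assume "{x, y} \<in> edges ({x. {w, x} \<in> edges G}, {e \<in> edges G. e \<subseteq> {x. {w, x} \<in> edges G}})"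
    then have e: "{x, y} \<in> edges G" and "x \<in> I \<union> O'" "y \<in> I \<union> O'"
      by (auto simp: nbh)
    then show "(x, y) \<in> T \<longleftrightarrow> (y, x) \<notin> T"
      unfolding T_def using D_iff[OF e] disj no_OI by blast
  qed
  moreover have "trans T"
  proof (rule transI)
    fix x y z
    assume xy: "(x, y) \<in> T" and yz: "(y, z) \<in> T"
    consider (III) "x \<in> I" "y \<in> I" "z \<in> I" "(x, y) \<in> D" "(y, z) \<in> D"
      | (OOO) "x \<in> O'" "y \<in> O'" "z \<in> O'" "(x, y) \<in> D" "(y, z) \<in> D"
      | (OOI) "x \<in> O'" "y \<in> O'" "z \<in> I" "(x, y) \<in> D" "(z, y) \<in> D"
      | (OII) "x \<in> O'" "y \<in> I" "z \<in> I" "(y, x) \<in> D" "(y, z) \<in> D"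
      using xy yz disj unfolding T_def by blast
    then show "(x, z) \<in> T"
    proof cases
      case III
      then have "(x, z) \<in> D"
        using semi_transitive_orientation_shortcut3(1)[OF D, of x y z w] D_edge
        unfolding I_def by blast
      then show ?thesis using III unfolding T_def by blast
    next
      case OOO
      then have "(x, z) \<in> D"
        using semi_transitive_orientation_shortcut3(2)[OF D, of w x y z] D_edge
        unfolding O'_def by blast
      then show ?thesis using OOO unfolding T_def by blast
    next
      case OOI
      then have "(z, x) \<in> D"
        using semi_transitive_orientation_shortcut3(1)[OF D, of z w x y] D_edge
        unfolding I_def O'_def by blast
      then show ?thesis using OOI unfolding T_def by blast
    next
      case OII
      then have "(z, x) \<in> D"
        using semi_transitive_orientation_shortcut3(2)[OF D, of y z w x] D_edge
        unfolding I_def O'_def by blast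
      then show ?thesis using OII unfolding T_def by blast
    qed
  qed
  ultimately show ?thesis using that by blast
qed

text \<open>
  At a triangle vertex \<open>x\<close>, the edge to the private neighbour \<open>p\<close> and each triangle edge must
  both leave \<open>x\<close> or both enter it, since transitivity would otherwise join \<open>p\<close> to another corner.
  So every corner is a source or a sink of the triangle, but an oriented triangle without a
  directed cycle has a middle vertex. The possible edges between \<open>p\<close>, \<open>q\<close> and \<open>r\<close> are left open,
  so that the lemma covers both the net and the prism.
\<close>

lemma no_transitive_orientation_triangle_private:
  assumes ori: "orientation G T" and tr: "trans T"
    and triangle: "{x, y} \<in> edges G" "{x, z} \<in> edges G" "{y, z} \<in> edges G"
    and own: "{x, p} \<in> edges G" "{y, q} \<in> edges G" "{z, r} \<in> edges G"
    and non: "{p, y} \<notin> edges G" "{p, z} \<notin> edges G" "{q, x} \<notin> edges G" "{q, z} \<notin> edges G"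
      "{r, x} \<notin> edges G" "{r, y} \<notin> edges G"
  shows False
proof -
  have T_iff: "(u, v) \<in> T \<longleftrightarrow> (v, u) \<notin> T" if "{u, v} \<in> edges G" for u v
    using ori that unfolding orientation_def by blast
  have T_edge: "{u, v} \<in> edges G" if "(u, v) \<in> T" for u v
    using ori that unfolding orientation_def by blast
  have force: "(u, v) \<in> T \<longleftrightarrow> (u, s) \<in> T"
    if "{u, v} \<in> edges G" "{u, s} \<in> edges G" "{s, v} \<notin> edges G" for u v s
  proof -
    have "(s, v) \<notin> T" "(v, s) \<notin> T"
      using T_edge[of s v] T_edge[of v s] that(3) by (auto simp: insert_commute)
    then show ?thesis
      using T_iff[OF that(1)] T_iff[OF that(2)] tr by (blast dest: transD)
  qed
  have sym: "{y, x} \<in> edges G" "{z, x} \<in> edges G" "{z, y} \<in> edges G"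
    using triangle by (simp_all add: insert_commute)
  have "(x, y) \<in> T \<longleftrightarrow> (x, z) \<in> T" "(y, x) \<in> T \<longleftrightarrow> (y, z) \<in> T" "(z, x) \<in> T \<longleftrightarrow> (z, y) \<in> T"
    using force triangle sym own non by blast+
  then show False
    using T_iff triangle by blast
qed

lemma complement_kneser_edge:
  "{A, B} \<in> edges (complement_graph (kneser_graph n k)) \<longleftrightarrow>
    A \<in> kneser_verts n k \<and> B \<in> kneser_verts n k \<and> A \<noteq> B \<and> A \<inter> B \<noteq> {}"
  by (auto simp: complement_graph_def kneser_graph_def doubleton_eq_iff)

lemma disjoint_kneser_verts_iff:
  assumes n: "n \<le> 2 * k" and A: "A \<in> kneser_verts n k" and B: "B \<in> kneser_verts n k"
  shows "A \<inter> B = {} \<longleftrightarrow> B = {1..n} - A"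
proof
  have sub: "A \<subseteq> {1..n}" "B \<subseteq> {1..n}" and card: "card A = k" "card B = k"
    using A B by (auto simp: kneser_verts_def)
  then have fin: "finite A" "finite B" by (auto intro: finite_subset)
  assume disj: "A \<inter> B = {}"
  then have "card (A \<union> B) = 2 * k"
    using card fin by (simp add: card_Un_disjoint)
  then have "A \<union> B = {1..n}"
    using sub n by (intro card_seteq) auto
  then show "B = {1..n} - A" using disj by blast
qed blast

lemma complement_kneser_semi_transitive:
  assumes "n \<le> 2 * k"
  shows "semi_transitive (complement_graph (kneser_graph n k))"
proof (rule complete_multipartite_semi_transitive)
  have V: "verts (complement_graph (kneser_graph n k)) = kneser_verts n k"
    by (simp add: complement_graph_def kneser_graph_def)
  show "finite (verts (complement_graph (kneser_graph n k)))"
    unfolding V kneser_verts_def by (rule finite_subset[of _ "Pow {1..n}"]) auto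
  show "x \<in> verts (complement_graph (kneser_graph n k)) \<and>
      y \<in> verts (complement_graph (kneser_graph n k))"
    if "{x, y} \<in> edges (complement_graph (kneser_graph n k))" for x y
    using that unfolding complement_kneser_edge V by blast
  show "{A, B} \<in> edges (complement_graph (kneser_graph n k)) \<longleftrightarrow>
      {A, {1..n} - A} \<noteq> {B, {1..n} - B}"
    if "A \<in> verts (complement_graph (kneser_graph n k))"
      "B \<in> verts (complement_graph (kneser_graph n k))" for A B
  proof -
    have AB: "A \<in> kneser_verts n k" "B \<in> kneser_verts n k"
      using that unfolding V by blast+
    then have "A \<subseteq> {1..n}" by (simp add: kneser_verts_def)
    then have "{A, {1..n} - A} = {B, {1..n} - B} \<longleftrightarrow> A = B \<or> B = {1..n} - A"
      by (auto simp: doubleton_eq_iff)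
    then show ?thesis
      using AB disjoint_kneser_verts_iff[OF assms AB] unfolding complement_kneser_edge by blast
  qed
qed

lemma complement_kneser_not_semi_transitive:
  assumes k: "k \<ge> 2" and n: "n > 2 * k"
  shows "\<not> semi_transitive (complement_graph (kneser_graph n k))" (is "\<not> semi_transitive ?G")
proof
  assume st: "semi_transitive ?G"
  define S where "S i = insert i {1..<k}" for i :: nat
  define P where "P i = insert i {k..<2 * k - 1}" for i :: nat
  \<comment> \<open>\<open>W\<close> meets both \<open>{1..<k}\<close> and \<open>{k..<2 * k - 1}\<close>, hence every \<open>S i\<close> and every \<open>P i\<close>.\<close>
  define W where "W = {1..k}"
  define N where "N = {X. {W, X} \<in> edges ?G}"
  obtain T where ori: "orientation (N, {e \<in> edges ?G. e \<subseteq> N}) T" and tr: "trans T"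
    by (rule neighbourhood_transitive_orientation[OF st, of W, folded N_def])
  define J where "J = {2 * k - 1..2 * k + 1}"
  have J: "2 * k - 1 \<in> J" "2 * k \<in> J" "2 * k + 1 \<in> J"
    unfolding J_def by auto
  have J_ge: "i \<ge> 2 * k - 1" "i \<le> n" if "i \<in> J" for i
    using that n unfolding J_def by auto
  have SV: "S i \<in> kneser_verts n k" and PV: "P i \<in> kneser_verts n k" if "i \<in> J" for i
    subgoal using J_ge[OF that] k n unfolding S_def kneser_verts_def by (auto simp: card_insert_if)
    subgoal using J_ge[OF that] k n unfolding P_def kneser_verts_def by (auto simp: card_insert_if)
    done
  have WV: "W \<in> kneser_verts n k"
    using n unfolding W_def kneser_verts_def by auto
  have memS: "1 \<in> S i" "i \<in> S i" and memP: "k \<in> P i" "i \<in> P i" for i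
    using k unfolding S_def P_def by auto
  have memW: "1 \<in> W" "k \<in> W" using k unfolding W_def by auto
  have notS: "k \<notin> S i" and notP: "1 \<notin> P i" if "i \<in> J" for i
    using J_ge[OF that] k unfolding S_def P_def by auto
  have notin: "i \<notin> S j" "i \<notin> P j" if "i \<in> J" "i \<noteq> j" for i j
    using J_ge[OF that(1)] that(2) k unfolding S_def P_def by auto
  have SN: "S i \<in> N" and PN: "P i \<in> N" if "i \<in> J" for i
    unfolding N_def complement_kneser_edge mem_Collect_eq
    using WV SV[OF that] PV[OF that] memS[of i] memP[of i] memW notS[OF that] notP[OF that] by blast+
  have SS: "{S i, S j} \<in> {e \<in> edges ?G. e \<subseteq> N}" if "i \<in> J" "j \<in> J" "i \<noteq> j" for i j
  proof -
    have "{S i, S j} \<in> edges ?G"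
      unfolding complement_kneser_edge
      using SV[OF that(1)] SV[OF that(2)] memS[of i] memS[of j] notin(1)[OF that(1,3)] by blast
    then show ?thesis using SN that by simp
  qed
  have SP: "{S i, P i} \<in> {e \<in> edges ?G. e \<subseteq> N}" if "i \<in> J" for i
  proof -
    have "{S i, P i} \<in> edges ?G"
      unfolding complement_kneser_edge
      using SV[OF that] PV[OF that] memS[of i] memP[of i] notS[OF that] by blast
    then show ?thesis using SN PN that by simp
  qed
  have PS: "{P i, S j} \<notin> {e \<in> edges ?G. e \<subseteq> N}" if "i \<in> J" "j \<in> J" "i \<noteq> j" for i j
  proof -
    have "P i \<inter> S j = {}"
      using J_ge[OF that(1)] J_ge[OF that(2)] that(3) k unfolding S_def P_def by auto
    then show ?thesis by (simp add: complement_kneser_edge)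
  qed
  show False
    by (rule no_transitive_orientation_triangle_private[OF ori tr,
          of "S (2 * k - 1)" "S (2 * k)" "S (2 * k + 1)"
             "P (2 * k - 1)" "P (2 * k)" "P (2 * k + 1)"])
      (unfold snd_conv; (rule SS SP PS; use J k in simp))+
qed

theorem theorem18:
  fixes n k :: nat
  assumes "k \<ge> 1" and "n \<ge> k"
    and "\<not> (k = 1 \<and> n \<ge> 3)"
  shows "semi_transitive (complement_graph (kneser_graph n k)) \<longleftrightarrow> n \<le> 2 * k"
proof
  assume "semi_transitive (complement_graph (kneser_graph n k))"
  then have "\<not> (k \<ge> 2 \<and> n > 2 * k)"
    using complement_kneser_not_semi_transitive by blast
  then show "n \<le> 2 * k" using assms by linarith
next
  assume "n \<le> 2 * k"
  then show "semi_transitive (complement_graph (kneser_graph n k))"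
    by (rule complement_kneser_semi_transitive)
qed

end
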